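(* For $c\in\mathbb{R}$ let $D_c$ be the germ at $0\in\mathbb{R}^{17}(t,x_1,y_1,\dots,x_8,y_8)$ of the rank-$3$ distribution given by the Pfaffian equations $$\begin{aligned} dx_1-x_2dt&=0, & dy_1-y_2dt&=0,\\ dt-x_3dx_2&=0, & dy_2-y_3dx_2&=0,\\ dx_3-(1+x_4)dx_2&=0, & dy_3-y_4dx_2&=0,\\ dx_2-x_5dx_4&=0, & dy_4-y_5dx_4&=0,\\ dx_5-(1+x_6)dx_4&=0, & dy_5-y_6dx_4&=0,\\ dx_4-x_7dx_6&=0, & dy_6-y_7dx_6&=0,\\ dx_7-(c+x_8)dx_6&=0, & dy_7-y_8dx_6&=0. \end{aligned}$$ Then for any two different real values $c\neq\tilde c$ the germs $D_c$ and $D_{\tilde c}$ are non-equivalent.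
   Context: A distribution given by Pfaffian equations is the common kernel of the listed $1$-forms. Two germs of distributions at $0\in\mathbb{R}^{17}$ are equivalent if there is a local diffeomorphism $\Phi:(\mathbb{R}^{17},0)\to(\mathbb{R}^{17},0)$ (of class $C^\infty$, or real-analytic), preserving $0$, that sends one to the other: $\Phi_*D=\tilde D$. *)

theory Defs
  imports "HOL-Analysis.Analysis"
begin

section \<open>Smooth and real-analytic maps\<close>

text \<open>The following predicates are meant for open sets \<open>S\<close>; in finite dimension they are the
  usual classes \<open>C\<^sup>k\<close>, \<open>C\<^sup>\<infinity>\<close> and \<open>C\<^sup>\<omega>\<close>.\<close>

primrec Ck_on ::
    "nat \<Rightarrow> 'a::euclidean_space set \<Rightarrow> ('a \<Rightarrow> 'b::euclidean_space) \<Rightarrow> bool" where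
  "Ck_on 0 S f \<longleftrightarrow> continuous_on S f"
| "Ck_on (Suc k) S f \<longleftrightarrow>
     (\<forall>p\<in>S. f differentiable (at p)) \<and>
     (\<forall>v. Ck_on k S (\<lambda>p. frechet_derivative f (at p) v))"

definition smooth_on ::
    "'a::euclidean_space set \<Rightarrow> ('a \<Rightarrow> 'b::euclidean_space) \<Rightarrow> bool" where
  "smooth_on S f \<longleftrightarrow> (\<forall>k. Ck_on k S f)"

text \<open>The power series is summed over all multi-indices \<open>\<alpha>\<close>; it is necessarily the Taylor series
  of \<open>f\<close> at \<open>a\<close>. The smoothness conjunct is implied by the existence of these expansions.\<close>

definition real_analytic_on ::
    "(real^'n::finite) set \<Rightarrow> (real^'n \<Rightarrow> 'b::euclidean_space) \<Rightarrow> bool" where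
  "real_analytic_on S f \<longleftrightarrow>
     smooth_on S f \<and>
     (\<forall>a\<in>S. \<exists>r>0. \<exists>C :: ('n \<Rightarrow> nat) \<Rightarrow> 'b. \<forall>h. norm h < r \<longrightarrow>
        ((\<lambda>\<alpha>. (\<Prod>i\<in>UNIV. (h $ i) ^ \<alpha> i) *\<^sub>R C \<alpha>) has_sum f (a + h)) UNIV)"


section \<open>Distributions and equivalence of their germs\<close>

text \<open>Tangent spaces of a Euclidean space are identified with the space itself.\<close>

type_synonym 'a distribution = "'a \<Rightarrow> 'a set"
type_synonym 'a one_form = "'a \<Rightarrow> 'a \<Rightarrow> real"

definition differential :: "('a::euclidean_space \<Rightarrow> real) \<Rightarrow> 'a one_form" where
  "differential f = (\<lambda>p v. frechet_derivative f (at p) v)"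

definition pfaffian_distribution :: "'a one_form list \<Rightarrow> 'a distribution" where
  "pfaffian_distribution \<omega>s = (\<lambda>p. {v. \<forall>\<omega>\<in>set \<omega>s. \<omega> p v = 0})"

text \<open>\<open>\<Psi>\<close> plays the role of the inverse of \<open>\<Phi>\<close>.\<close>

definition pushforward ::
    "('a::euclidean_space \<Rightarrow> 'a) \<Rightarrow> ('a \<Rightarrow> 'a) \<Rightarrow> 'a distribution \<Rightarrow> 'a distribution" where
  "pushforward \<Phi> \<Psi> D = (\<lambda>q. frechet_derivative \<Phi> (at (\<Psi> q)) ` D (\<Psi> q))"

text \<open>Germs at \<open>0\<close> are given by representatives defined everywhere; as the neighbourhoods \<open>U\<close>
  and \<open>V\<close> of \<open>0\<close> may be arbitrarily small, equivalence depends on the germs only. The parameter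
  \<open>reg\<close> is the regularity class required of \<open>\<Phi>\<close> and of its inverse.\<close>

definition germ_equivalent ::
    "('a::euclidean_space set \<Rightarrow> ('a \<Rightarrow> 'a) \<Rightarrow> bool) \<Rightarrow> 'a distribution \<Rightarrow> 'a distribution \<Rightarrow> bool"
  where
  "germ_equivalent reg D D' \<longleftrightarrow>
     (\<exists>U V \<Phi> \<Psi>. open U \<and> open V \<and> 0 \<in> U \<and> \<Phi> 0 = 0 \<and>
        homeomorphism U V \<Phi> \<Psi> \<and> reg U \<Phi> \<and> reg V \<Psi> \<and>
        (\<forall>q\<in>V. pushforward \<Phi> \<Psi> D q = D' q))"


section \<open>The distributions \<open>D\<^sub>c\<close>\<close>

text \<open>Coordinates \<open>(t, x\<^sub>1, y\<^sub>1, \<dots>, x\<^sub>8, y\<^sub>8)\<close>; the elements of the index type \<open>17\<close> are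
  \<open>0, \<dots>, 16\<close>.\<close>

definition tc :: "real^17 \<Rightarrow> real" where
  "tc p = p $ 0"

definition xc :: "nat \<Rightarrow> real^17 \<Rightarrow> real" where
  "xc i p = p $ of_nat (2 * i - 1)"

definition yc :: "nat \<Rightarrow> real^17 \<Rightarrow> real" where
  "yc i p = p $ of_nat (2 * i)"

text \<open>The 1-form \<open>df - h dg\<close>.\<close>

definition pfaff ::
    "('a::euclidean_space \<Rightarrow> real) \<Rightarrow> ('a \<Rightarrow> real) \<Rightarrow> ('a \<Rightarrow> real) \<Rightarrow> 'a one_form" where
  "pfaff f h g = (\<lambda>p v. differential f p v - h p * differential g p v)"

definition D :: "real \<Rightarrow> (real^17) distribution" where
  "D c = pfaffian_distribution
    [pfaff (xc 1) (xc 2) tc,                       pfaff (yc 1) (yc 2) tc,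
     pfaff tc (xc 3) (xc 2),                       pfaff (yc 2) (yc 3) (xc 2),
     pfaff (xc 3) (\<lambda>p. 1 + xc 4 p) (xc 2),         pfaff (yc 3) (yc 4) (xc 2),
     pfaff (xc 2) (xc 5) (xc 4),                   pfaff (yc 4) (yc 5) (xc 4),
     pfaff (xc 5) (\<lambda>p. 1 + xc 6 p) (xc 4),         pfaff (yc 5) (yc 6) (xc 4),
     pfaff (xc 4) (xc 7) (xc 6),                   pfaff (yc 6) (yc 7) (xc 6),
     pfaff (xc 7) (\<lambda>p. c + xc 8 p) (xc 6),         pfaff (yc 7) (yc 8) (xc 6)]"

end

theory Submission
  imports Defs
begin

text \<open>
  Let \<open>\<Phi>\<close> be an equivalence. Forgetting the coordinates \<open>x\<^sub>i, y\<^sub>i\<close> with \<open>i > k\<close> turns the first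
  \<open>2(k - 1)\<close> equations into a distribution \<open>\<Delta>\<^sub>k\<close> on \<open>\<real>\<^bsup>2k + 1\<^esup>\<close>, and \<open>\<Phi>\<close> descends to an equivalence
  of the \<open>\<Delta>\<^sub>k\<close> for \<open>k = 8, 7, \<dots>, 1\<close>: by the symmetry of second derivatives, the vertical
  directions \<open>\<partial>/\<partial>x\<^sub>k, \<partial>/\<partial>y\<^sub>k\<close> of \<open>\<Delta>\<^sub>k\<close> are mapped to vertical ones, and \<open>\<Delta>\<^sub>k\<^sub>-\<^sub>1\<close> is spanned by the
  planes of \<open>\<Delta>\<^sub>k\<close> along a vertical fibre.

  Write \<open>X\<^sub>i\<close> for the components of \<open>\<Phi>\<close> and \<open>e\<^sub>k = \<partial>X\<^sub>k/\<partial>x\<^sub>k (0)\<close>. Comparing the pulled back equations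
  and their derivatives in the direction \<open>x\<^sub>k\<close> at \<open>0\<close> gives \<open>e\<^sub>2 = e\<^sub>5e\<^sub>4\<close>, \<open>e\<^sub>4 = e\<^sub>7e\<^sub>6\<close>, \<open>e\<^sub>3 = e\<^sub>2 = e\<^sub>4e\<^sub>2\<close>,
  \<open>e\<^sub>5 = e\<^sub>4 = e\<^sub>6e\<^sub>4\<close> and \<open>c e\<^sub>7 = c' e\<^sub>6\<close> with \<open>e\<^sub>2, e\<^sub>4, e\<^sub>6 \<noteq> 0\<close>. Hence \<open>e\<^sub>4 = e\<^sub>6 = e\<^sub>7 = 1\<close> and \<open>c = c'\<close>.
\<close>

section \<open>Symmetry of second derivatives\<close>


text \<open>The mean value theorem in the direction \<open>v\<close> turns the second difference
  into \<open>s\<close> times a difference of values of \<open>f' _ v\<close>, and differentiability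
  of \<open>f' _ v\<close> at \<open>p\<close> evaluates that difference up to \<open>o(s)\<close>.
  No continuity of second derivatives is involved.\<close>

lemma second_difference_quotient_tendsto:
  fixes f :: "'a::real_normed_vector \<Rightarrow> real"
  assumes U: "open U" "p \<in> U"
    and f': "\<And>q. q \<in> U \<Longrightarrow> (f has_derivative f' q) (at q)"
    and H: "((\<lambda>q. f' q v) has_derivative H) (at p)"
  shows "((\<lambda>s. (f (p + s *\<^sub>R v + s *\<^sub>R w) - f (p + s *\<^sub>R v) - f (p + s *\<^sub>R w) + f p) / s\<^sup>2)
            \<longlongrightarrow> H w) (at_right 0)"
proof (rule tendstoI)
  fix e :: real assume "e > 0"
  define N where "N = norm v + norm w"
  have N: "N \<ge> 0" "norm v \<le> N" by (auto simp: N_def)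
  \<comment> \<open>The error occurs at two points, hence the factor 2; the \<open>+ 1\<close>
    covers \<open>v = w = 0\<close>.\<close>
  define e1 where "e1 = e / (2 * N + 1)"
  have e1: "e1 > 0" "2 * e1 * N < e"
    using \<open>e > 0\<close> N by (auto simp: e1_def divide_simps)
  interpret H: bounded_linear H using H by (rule has_derivative_bounded_linear)
  obtain d1 where d1: "d1 > 0" "ball p d1 \<subseteq> U" using U openE by blast
  obtain d2 where d2: "d2 > 0"
    "\<And>q. norm (q - p) < d2 \<Longrightarrow> \<bar>f' q v - f' p v - H (q - p)\<bar> \<le> e1 * norm (q - p)"
    using H e1(1) unfolding has_derivative_at_alt by fastforce
  define d where "d = min d1 d2 / (N + 1)"
  have d: "d > 0" using d1 d2 N by (simp add: d_def)
  have small: "norm (x *\<^sub>R v + y *\<^sub>R w) \<le> s * N" "p + x *\<^sub>R v + y *\<^sub>R w \<in> U"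
    "\<bar>f' (p + x *\<^sub>R v + y *\<^sub>R w) v - f' p v - H (x *\<^sub>R v + y *\<^sub>R w)\<bar> \<le> e1 * (s * N)"
    if "0 \<le> x" "x \<le> s" "0 \<le> y" "y \<le> s" "0 < s" "s < d" for x y s
  proof -
    have "norm (x *\<^sub>R v + y *\<^sub>R w) \<le> x * norm v + y * norm w"
      using norm_triangle_ineq[of "x *\<^sub>R v" "y *\<^sub>R w"] that by simp
    also have "\<dots> \<le> s * norm v + s * norm w"
      using that by (intro add_mono mult_right_mono) auto
    finally show 1: "norm (x *\<^sub>R v + y *\<^sub>R w) \<le> s * N" by (simp add: N_def distrib_left)
    have "s * N \<le> s * (N + 1)" using that by simp
    also have "\<dots> < d * (N + 1)" using that N by (intro mult_strict_right_mono) auto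
    also have "\<dots> = min d1 d2" using N by (simp add: d_def)
    finally have 2: "norm (x *\<^sub>R v + y *\<^sub>R w) < min d1 d2" using 1 by linarith
    have "dist p (p + x *\<^sub>R v + y *\<^sub>R w) = norm (x *\<^sub>R v + y *\<^sub>R w)"
      by (metis add.assoc dist_commute dist_norm add_diff_cancel_left')
    then show "p + x *\<^sub>R v + y *\<^sub>R w \<in> U" using d1 2 by (auto simp: subset_iff)
    have "\<bar>f' (p + x *\<^sub>R v + y *\<^sub>R w) v - f' p v - H (x *\<^sub>R v + y *\<^sub>R w)\<bar>
        \<le> e1 * norm (x *\<^sub>R v + y *\<^sub>R w)"
      using d2(2)[of "p + x *\<^sub>R v + y *\<^sub>R w"] 2 by (simp add: add.assoc)
    also have "\<dots> \<le> e1 * (s * N)" using 1 e1 by (intro mult_left_mono) auto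
    finally show "\<bar>f' (p + x *\<^sub>R v + y *\<^sub>R w) v - f' p v - H (x *\<^sub>R v + y *\<^sub>R w)\<bar> \<le> e1 * (s * N)" .
  qed
  have main: "\<bar>(f (p + s *\<^sub>R v + s *\<^sub>R w) - f (p + s *\<^sub>R v) - f (p + s *\<^sub>R w) + f p) / s\<^sup>2 - H w\<bar> < e"
    if s: "0 < s" "s < d" for s
  proof -
    define g where "g = (\<lambda>x. f (p + x *\<^sub>R v + s *\<^sub>R w) - f (p + x *\<^sub>R v))"
    have "(g has_field_derivative (f' (p + x *\<^sub>R v + s *\<^sub>R w) v - f' (p + x *\<^sub>R v) v)) (at x)"
      if x: "0 \<le> x" "x \<le> s" for x
    proof -
      have U1: "p + x *\<^sub>R v + s *\<^sub>R w \<in> U" using small(2)[of x s s] x s by auto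
      have U2: "p + x *\<^sub>R v \<in> U" using small(2)[of x s 0] x s by auto
      have i: "((\<lambda>x. p + x *\<^sub>R v + s *\<^sub>R w) has_derivative (\<lambda>h. h *\<^sub>R v)) (at x)"
        "((\<lambda>x. p + x *\<^sub>R v) has_derivative (\<lambda>h. h *\<^sub>R v)) (at x)"
        by (auto intro!: derivative_eq_intros)
      have "(g has_derivative (\<lambda>h. f' (p + x *\<^sub>R v + s *\<^sub>R w) (h *\<^sub>R v) - f' (p + x *\<^sub>R v) (h *\<^sub>R v))) (at x)"
        unfolding g_def
        by (intro has_derivative_diff has_derivative_compose[OF i(1) f'[OF U1]]
            has_derivative_compose[OF i(2) f'[OF U2]])
      moreover have "linear (f' (p + x *\<^sub>R v + s *\<^sub>R w))" "linear (f' (p + x *\<^sub>R v))"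
        using f'[OF U1] f'[OF U2] has_derivative_linear by blast+
      ultimately show ?thesis
        by (simp add: has_field_derivative_def linear_cmul right_diff_distrib[symmetric] mult_commute_abs)
    qed
    from MVT2[OF s(1) this] obtain x where x: "0 < x" "x < s"
      "g s - g 0 = s * (f' (p + x *\<^sub>R v + s *\<^sub>R w) v - f' (p + x *\<^sub>R v) v)"
      by auto
    define r where "r = f' (p + x *\<^sub>R v + s *\<^sub>R w) v - f' (p + x *\<^sub>R v) v"
    have "\<bar>r - s * H w\<bar> \<le> 2 * (e1 * (s * N))"
      using small(3)[of x s s] small(3)[of x s 0] x s
      by (simp add: r_def H.add H.scaleR)
    also have "\<dots> = s * (2 * e1 * N)" by simp
    also have "\<dots> < s * e" using s e1 by (intro mult_strict_left_mono) auto
    finally have r: "\<bar>r - s * H w\<bar> < s * e" .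
    have "(f (p + s *\<^sub>R v + s *\<^sub>R w) - f (p + s *\<^sub>R v) - f (p + s *\<^sub>R w) + f p) / s\<^sup>2 - H w
        = (s * r) / s\<^sup>2 - H w"
      using x(3) by (simp add: g_def r_def algebra_simps)
    also have "\<dots> = (r - s * H w) / s" using s by (simp add: power2_eq_square field_simps)
    also have "\<bar>\<dots>\<bar> < e" using r s by (simp add: abs_divide pos_divide_less_eq mult.commute)
    finally show ?thesis .
  qed
  show "\<forall>\<^sub>F s in at_right 0. dist ((f (p + s *\<^sub>R v + s *\<^sub>R w) - f (p + s *\<^sub>R v) - f (p + s *\<^sub>R w) + f p) / s\<^sup>2) (H w) < e"
    unfolding eventually_at_right_field using d main by (auto simp: dist_real_def)
qed

text \<open>The second difference does not change when \<open>v\<close> and \<open>w\<close> are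
  exchanged, so its quotient tends to both sides.\<close>

lemma second_derivative_symmetric:
  fixes f :: "'a::real_normed_vector \<Rightarrow> real"
  assumes "open U" "p \<in> U"
    and "\<And>q. q \<in> U \<Longrightarrow> (f has_derivative f' q) (at q)"
    and "((\<lambda>q. f' q v) has_derivative H) (at p)"
    and "((\<lambda>q. f' q w) has_derivative K) (at p)"
  shows "H w = K v"
proof (rule tendsto_unique[OF trivial_limit_at_right_real])
  show "((\<lambda>s. (f (p + s *\<^sub>R v + s *\<^sub>R w) - f (p + s *\<^sub>R v) - f (p + s *\<^sub>R w) + f p) / s\<^sup>2)
            \<longlongrightarrow> H w) (at_right 0)"
    using second_difference_quotient_tendsto[OF assms(1-3,4)] by simp
  show "((\<lambda>s. (f (p + s *\<^sub>R v + s *\<^sub>R w) - f (p + s *\<^sub>R v) - f (p + s *\<^sub>R w) + f p) / s\<^sup>2)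
            \<longlongrightarrow> K v) (at_right 0)"
    using second_difference_quotient_tendsto[OF assms(1-3,5), of v]
    by (simp add: add.commute add.left_commute diff_diff_eq)
qed


section \<open>The tower of distributions\<close>

text \<open>This allows positions to be natural numbers below 17, which can be compared and computed
  with, instead of elements of the cyclic type.\<close>

lemma inj_on_of_nat_17: "inj_on (of_nat :: nat \<Rightarrow> 17) {..<17}"
  and surj_of_nat_17: "(of_nat :: nat \<Rightarrow> 17) ` {..<17} = UNIV"
proof -
  have "x \<in> (of_nat :: nat \<Rightarrow> 17) ` {..<17}" for x :: 17
  proof (cases x rule: bit1_cases)
    case (of_int z)
    then have "nat z < 17" "x = of_nat (nat z)" by auto
    then show ?thesis by blast
  qed
  then show *: "(of_nat :: nat \<Rightarrow> 17) ` {..<17} = UNIV" by blast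
  show "inj_on (of_nat :: nat \<Rightarrow> 17) {..<17}"
    by (rule eq_card_imp_inj_on) (simp_all add: *)
qed

text \<open>Position \<open>0\<close> is \<open>t\<close>, position \<open>2i - 1\<close> is \<open>x\<^sub>i\<close> and position \<open>2i\<close> is \<open>y\<^sub>i\<close>.\<close>

definition coord :: "nat \<Rightarrow> real^17 \<Rightarrow> real" where
  "coord i v = v $ of_nat i"

definition E :: "nat \<Rightarrow> real^17" where
  "E i = axis (of_nat i) 1"

lemma bounded_linear_coord: "bounded_linear (coord i)"
  unfolding coord_def by (rule bounded_linear_vec_nth)

lemma coord_simps [simp]:
  "coord i 0 = 0" "coord i (v + w) = coord i v + coord i w" "coord i (v - w) = coord i v - coord i w"
  "coord i (- v) = - coord i v" "coord i (r *\<^sub>R v) = r * coord i v"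
  by (simp_all add: coord_def)

lemma coord_E: "i < 17 \<Longrightarrow> j < 17 \<Longrightarrow> coord i (E j) = (if i = j then 1 else 0)"
  using inj_on_eq_iff[OF inj_on_of_nat_17, of i j]
  by (cases "i = j") (simp_all add: coord_def E_def axis_def)

lemma norm_E: "norm (E i) = 1"
  by (simp add: E_def norm_axis_1)

lemma coord_eqI:
  assumes "\<And>i. i < 17 \<Longrightarrow> coord i v = coord i w"
  shows "v = w"
proof -
  have "v $ n = w $ n" for n
  proof -
    have "n \<in> of_nat ` {..<17}" using surj_of_nat_17 by simp
    then show ?thesis using assms by (auto simp: coord_def)
  qed
  then show ?thesis by (simp add: vec_eq_iff)
qed

text \<open>The \<open>k\<close>-th pair of equations is \<open>du - (s + x\<^sub>k\<^sub>+\<^sub>1)dw = 0\<close>, \<open>dy\<^sub>k - y\<^sub>k\<^sub>+\<^sub>1dw = 0\<close>, where \<open>u\<close> has position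
  \<open>partner k\<close>, \<open>w\<close> has position \<open>pivot (Suc k)\<close> and \<open>s = shift c k\<close>. So \<open>{u, w}\<close> consists of \<open>x\<^sub>k\<close> and
  of the previous \<open>w\<close>.\<close>

primrec pivot :: "nat \<Rightarrow> nat" where
  "pivot 0 = 0"
| "pivot (Suc k) = (if even k \<and> 0 < k then 2 * k - 1 else pivot k)"

definition partner :: "nat \<Rightarrow> nat" where
  "partner k = (if even k then pivot k else 2 * k - 1)"

definition shift :: "real \<Rightarrow> nat \<Rightarrow> real" where
  "shift c k = (if k = 7 then c else if k = 3 \<or> k = 5 then 1 else 0)"

text \<open>\<open>flag c k\<close> is the inverse image of \<open>\<Delta>\<^sub>k\<close> on \<open>\<real>\<^bsup>17\<^esup>\<close>; it is spanned by \<open>gen c k\<close> and \<open>fib (k - 1)\<close>.\<close>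

definition flag :: "real \<Rightarrow> nat \<Rightarrow> (real^17) distribution" where
  "flag c k p = {v. \<forall>j\<in>{1..<k}.
      coord (partner j) v = (shift c j + coord (2 * j + 1) p) * coord (pivot (Suc j)) v \<and>
      coord (2 * j) v = coord (2 * j + 2) p * coord (pivot (Suc j)) v}"

text \<open>The kernel of the projection that forgets \<open>x\<^sub>i, y\<^sub>i\<close> for
  \<open>i > k\<close>.\<close>

definition fib :: "nat \<Rightarrow> (real^17) set" where
  "fib k = {v. \<forall>i\<le>2 * k. coord i v = 0}"

text \<open>Normalised to have component 1 at \<open>pivot k\<close>. For even \<open>k > 0\<close>
  the pivot moves to \<open>x\<^sub>k\<close>, so the old generator enters with coefficient
  \<open>x\<^sub>k\<^sub>+\<^sub>1\<close>; for odd \<open>k\<close> the pivot stays. The value at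
  index 0 is a dummy.\<close>

primrec gen :: "real \<Rightarrow> nat \<Rightarrow> real^17 \<Rightarrow> real^17" where
  "gen c 0 p = E 0"
| "gen c (Suc k) p =
     (if k = 0 then E 0
      else if even k then E (2 * k - 1) + coord (2 * k + 2) p *\<^sub>R E (2 * k) + coord (2 * k + 1) p *\<^sub>R gen c k p
      else (shift c k + coord (2 * k + 1) p) *\<^sub>R E (2 * k - 1) + coord (2 * k + 2) p *\<^sub>R E (2 * k)
           + gen c k p)"

lemma frechet_derivative_coord: "frechet_derivative (coord i) (at p) = coord i"
  by (rule frechet_derivative_at[symmetric])
    (rule bounded_linear_imp_has_derivative[OF bounded_linear_coord])

lemma pivot_values:
  "pivot 2 = 0" "pivot 3 = 3" "pivot 4 = 3" "pivot 5 = 7" "pivot 6 = 7" "pivot 7 = 11" "pivot 8 = 11"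
proof -
  have s: "2 = Suc 1" "3 = Suc 2" "4 = Suc 3" "5 = Suc 4" "6 = Suc 5" "7 = Suc 6" "8 = Suc 7"
    by simp_all
  show 2: "pivot 2 = 0" unfolding s(1) pivot.simps by simp
  show 3: "pivot 3 = 3" unfolding s(2) pivot.simps by simp
  show 4: "pivot 4 = 3" unfolding s(3) pivot.simps using 3 by simp
  show 5: "pivot 5 = 7" unfolding s(4) pivot.simps by simp
  show 6: "pivot 6 = 7" unfolding s(5) pivot.simps using 5 by simp
  show 7: "pivot 7 = 11" unfolding s(6) pivot.simps by simp
  show 8: "pivot 8 = 11" unfolding s(7) pivot.simps using 7 by simp
qed

lemma partner_values:
  "partner (Suc 0) = 1" "partner 2 = 0" "partner 3 = 5" "partner 4 = 3" "partner 5 = 9" "partner 6 = 7"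
  "partner 7 = 13"
  by (simp_all add: partner_def pivot_values)

lemma shift_even [simp]: "even k \<Longrightarrow> shift c k = 0"
  by (auto simp: shift_def)

lemma D_eq_flag: "D c = flag c 8"
proof -
  have *: "{1..<8} = {1,2,3,4,5,6,7::nat}" by auto
  have co: "tc = coord 0" "xc i = coord (2 * i - 1)" "yc i = coord (2 * i)" for i
    by (auto simp: tc_def xc_def yc_def coord_def)
  have "v \<in> D c p \<longleftrightarrow> v \<in> flag c 8 p" for v p
    unfolding D_def pfaffian_distribution_def pfaff_def differential_def co frechet_derivative_coord
      flag_def *
    by (simp add: partner_values shift_def pivot_values)
  then show ?thesis by blast
qed

section \<open>Linear algebra of a single level\<close>

lemma pivot_le: "pivot (Suc k) \<le> 2 * k - 1"
proof (induction k)
  case (Suc k)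
  then show ?case by (cases "even (Suc k)") auto
qed simp

lemma pivot_le': "1 \<le> k \<Longrightarrow> pivot k \<le> 2 * k - 2"
  using pivot_le[of "k - 1"] by (cases k) auto

lemma partner_le: "1 \<le> k \<Longrightarrow> partner k \<le> 2 * k - 1"
  using pivot_le'[of k] by (auto simp: partner_def)

lemma flag_1 [simp]: "flag c (Suc 0) p = UNIV"
  by (auto simp: flag_def)

lemma flag_Suc:
  assumes "1 \<le> k"
  shows "v \<in> flag c (Suc k) p \<longleftrightarrow> v \<in> flag c k p \<and>
      coord (partner k) v = (shift c k + coord (2 * k + 1) p) * coord (pivot (Suc k)) v \<and>
      coord (2 * k) v = coord (2 * k + 2) p * coord (pivot (Suc k)) v"
proof -
  have "{1..<Suc k} = insert k {1..<k}" using assms by auto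
  then show ?thesis unfolding flag_def mem_Collect_eq by (simp only: ball_simps) blast
qed

lemma subspace_flag: "subspace (flag c k p)"
proof (rule subspaceI)
  show "0 \<in> flag c k p" by (simp add: flag_def)
  show "v + w \<in> flag c k p" if "v \<in> flag c k p" "w \<in> flag c k p" for v w
    using that unfolding flag_def mem_Collect_eq coord_simps distrib_left by metis
  show "r *\<^sub>R v \<in> flag c k p" if "v \<in> flag c k p" for r v
    using that unfolding flag_def mem_Collect_eq coord_simps by (metis mult.left_commute)
qed

lemma subspace_fib: "subspace (fib k)"
  by (auto simp: subspace_def fib_def)

text \<open>The equations with index below \<open>k\<close> involve the point up to
  \<open>y\<^sub>k\<close> but the vector only up to \<open>y\<^sub>k\<^sub>-\<^sub>1\<close>. This
  gap is why \<open>fib (k - 1)\<close> is contained in \<open>flag c k p\<close>.\<close>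

lemma flag_cong:
  assumes "\<And>i. i \<le> 2 * k \<Longrightarrow> coord i p = coord i q"
    and "\<And>i. i \<le> 2 * k - 2 \<Longrightarrow> coord i v = coord i w"
    and "v \<in> flag c k p"
  shows "w \<in> flag c k q"
  unfolding flag_def
proof (clarify, goal_cases)
  case (1 j)
  then have j: "1 \<le> j" "Suc j \<le> k" by auto
  have "partner j \<le> 2 * k - 2" "pivot (Suc j) \<le> 2 * k - 2" "2 * j \<le> 2 * k - 2"
    "2 * j + 1 \<le> 2 * k" "2 * j + 2 \<le> 2 * k"
    using partner_le[of j] pivot_le[of j] j by linarith+
  note assms(2)[OF this(1)] assms(2)[OF this(2)] assms(2)[OF this(3)] assms(1)[OF this(4)] assms(1)[OF this(5)]
  moreover have "coord (partner j) v = (shift c j + coord (2 * j + 1) p) * coord (pivot (Suc j)) v"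
    "coord (2 * j) v = coord (2 * j + 2) p * coord (pivot (Suc j)) v"
    using assms(3) 1 unfolding flag_def by blast+
  ultimately show ?case by simp
qed

lemma fibD: "v \<in> fib k \<Longrightarrow> i \<le> 2 * k \<Longrightarrow> coord i v = 0"
  by (simp add: fib_def)

lemma fib_subset_flag: "fib (k - 1) \<subseteq> flag c k p"
proof
  fix v assume "v \<in> fib (k - 1)"
  then have *: "coord i 0 = coord i v" if "i \<le> 2 * k - 2" for i
    using fibD[of v "k - 1" i] that by simp
  have "0 \<in> flag c k p" using subspace_flag subspace_0 by blast
  then show "v \<in> flag c k p" using flag_cong[OF refl *] by blast
qed

text \<open>The positions \<open>partner k\<close> and \<open>pivot (Suc k)\<close> are
  \<open>pivot k\<close> and that of \<open>x\<^sub>k\<close> in some order. If the component at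
  \<open>pivot (Suc k)\<close> vanishes, the last pair of equations kills those at
  \<open>partner k\<close> and \<open>y\<^sub>k\<close>, and the induction hypothesis applies one
  level down.\<close>

lemma flag_pivot_zero:
  assumes "1 \<le> k" "v \<in> flag c k p" "coord (pivot k) v = 0"
  shows "v \<in> fib (k - 1)"
  using assms
proof (induction k rule: nat_induct_at_least)
  case base
  then show ?case by (simp add: fib_def)
next
  case (Suc k)
  have z: "coord (partner k) v = 0" "coord (2 * k) v = 0" and f: "v \<in> flag c k p"
    using Suc.prems(1) unfolding flag_Suc[OF Suc.hyps] Suc.prems(2) mult_zero_right by blast+
  have p: "coord (pivot k) v = 0 \<and> coord (2 * k - 1) v = 0"
  proof (cases "even k")
    case True
    then show ?thesis using z(1) Suc.prems(2) Suc.hyps by (simp add: partner_def)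
  next
    case False
    then show ?thesis using z(1) Suc.prems(2) Suc.hyps by (simp add: partner_def)
  qed
  have f: "v \<in> fib (k - 1)" using Suc.IH f p by blast
  have "coord i v = 0" if "i \<le> 2 * k" for i
  proof -
    have "i \<le> 2 * (k - 1) \<or> i = 2 * k - 1 \<or> i = 2 * k" using that by linarith
    then show ?thesis using p z(2) fibD[OF f] by blast
  qed
  then show ?case by (simp add: fib_def)
qed

lemma E_in_fib: "2 * k < i \<Longrightarrow> i < 17 \<Longrightarrow> E i \<in> fib k"
  by (simp add: fib_def coord_E)

lemma coord_gen_eq_0:
  assumes "1 \<le> k" "k \<le> 8" "2 * k - 2 < i" "i < 17"
  shows "coord i (gen c k p) = 0"
  using assms by (induction k rule: nat_induct_at_least) (auto simp: coord_E)

lemma coord_pivot_gen: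
  assumes "1 \<le> k" "k \<le> 8"
  shows "coord (pivot k) (gen c k p) = 1"
  using assms
proof (induction k rule: nat_induct_at_least)
  case base
  then show ?case by (simp add: coord_E)
next
  case (Suc k)
  have "coord (2 * k - 1) (gen c k p) = 0"
    using Suc by (intro coord_gen_eq_0) auto
  moreover have "pivot k \<noteq> 2 * k - 1" "pivot k \<noteq> 2 * k" "pivot k < 17"
    using pivot_le'[of k] Suc by auto
  ultimately show ?case using Suc by (auto simp: coord_E)
qed

lemma gen_cong:
  assumes "\<And>i. i \<le> 2 * k \<Longrightarrow> coord i p = coord i q"
  shows "gen c k p = gen c k q"
  using assms
proof (induction k)
  case (Suc k)
  then have "gen c k p = gen c k q" "coord (2*k+1) p = coord (2*k+1) q"
    "coord (2*k+2) p = coord (2*k+2) q" by auto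
  then show ?case by simp
qed simp

lemma gen_in_flag:
  assumes "1 \<le> k" "k \<le> 8"
  shows "gen c k p \<in> flag c k p"
  using assms
proof (induction k rule: nat_induct_at_least)
  case base
  then show ?case by simp
next
  case (Suc k)
  have 1: "coord (pivot k) (gen c k p) = 1" "coord (2 * k - 1) (gen c k p) = 0" "coord (2 * k) (gen c k p) = 0"
    using Suc by (auto intro!: coord_pivot_gen coord_gen_eq_0)
  have 2: "pivot k \<noteq> 2 * k - 1" "pivot k \<noteq> 2 * k" "pivot k < 17"
    using pivot_le'[of k] Suc by auto
  have "E (2 * k - 1) \<in> fib (k - 1)" "E (2 * k) \<in> fib (k - 1)"
    using Suc by (auto intro!: E_in_fib)
  then have "E (2 * k - 1) \<in> flag c k p" "E (2 * k) \<in> flag c k p" "gen c k p \<in> flag c k p"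
    using fib_subset_flag Suc by auto
  then have "gen c (Suc k) p \<in> flag c k p"
    using subspace_flag by (auto intro!: subspace_add subspace_scale)
  then show ?case
    using 1 2 Suc.hyps Suc.prems by (auto simp: flag_Suc coord_E partner_def simp del: One_nat_def)
qed

lemma flag_minus_gen:
  assumes "1 \<le> k" "k \<le> 8" "v \<in> flag c k p"
  shows "v - coord (pivot k) v *\<^sub>R gen c k p \<in> fib (k - 1)"
  using assms coord_pivot_gen[OF assms(1,2)] gen_in_flag[OF assms(1,2)] subspace_flag
  by (intro flag_pivot_zero[of k _ c p]) (auto intro!: subspace_diff subspace_scale)

lemma fib_reduce:
  assumes "1 \<le> k" "k \<le> 8" "v \<in> fib (k - 1)"
  shows "v - coord (2 * k - 1) v *\<^sub>R E (2 * k - 1) - coord (2 * k) v *\<^sub>R E (2 * k) \<in> fib k"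
  unfolding fib_def
proof (clarify)
  fix i assume "i \<le> 2 * k"
  then consider "i \<le> 2 * (k - 1)" | "i = 2 * k - 1" | "i = 2 * k" by linarith
  then show "coord i (v - coord (2 * k - 1) v *\<^sub>R E (2 * k - 1) - coord (2 * k) v *\<^sub>R E (2 * k)) = 0"
    using assms by cases (auto simp: coord_E fib_def)
qed

text \<open>By dimension, an injective linear map that sends \<open>S\<close> into itself maps it
  onto \<open>S\<close>, so no vector outside \<open>S\<close> can land there.\<close>

lemma inj_invariant_subspace:
  fixes f :: "'a::euclidean_space \<Rightarrow> 'a"
  assumes "linear f" "inj f" "subspace S" "f ` S \<subseteq> S" "f v \<in> S"
  shows "v \<in> S"
proof -
  have "f ` S = S"
  proof (rule subspace_dim_equal)
    show "subspace (f ` S)" using assms linear_subspace_image by blast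
    show "dim (f ` S) \<ge> dim S" using dim_image_eq[OF assms(1), of S] assms(2) by (simp add: inj_on_subset)
  qed (use assms in auto)
  then show ?thesis using assms by (metis inj_image_mem_iff)
qed


section \<open>Equivalences descend along the tower\<close>

lemma constant_on_segment:
  fixes f :: "'a::real_normed_vector \<Rightarrow> real"
  assumes "\<And>q. q \<in> ball p r \<Longrightarrow> (f has_derivative f' q) (at q)"
    and "\<And>q. q \<in> ball p r \<Longrightarrow> f' q v = 0"
    and s: "norm (s *\<^sub>R v) < r"
  shows "f (p + s *\<^sub>R v) = f p"
proof -
  have "((\<lambda>x. f (p + x *\<^sub>R (s *\<^sub>R v))) has_derivative (\<lambda>h. 0)) (at x within {0..1})"
    if x: "x \<in> {0..1}" for x :: real
  proof -
    have "norm (x *\<^sub>R s *\<^sub>R v) \<le> norm (s *\<^sub>R v)"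
      using x mult_right_mono[of x 1 "norm (s *\<^sub>R v)"] by (simp add: abs_mult mult.assoc)
    then have b: "p + x *\<^sub>R s *\<^sub>R v \<in> ball p r"
      using s by (simp add: dist_norm)
    have i: "((\<lambda>x. p + x *\<^sub>R s *\<^sub>R v) has_derivative (\<lambda>h. h *\<^sub>R s *\<^sub>R v)) (at x within {0..1})"
      by (auto intro!: derivative_eq_intros)
    have "linear (f' (p + x *\<^sub>R s *\<^sub>R v))"
      using assms(1)[OF b] has_derivative_linear by blast
    then have "(\<lambda>h. f' (p + x *\<^sub>R s *\<^sub>R v) (h *\<^sub>R s *\<^sub>R v)) = (\<lambda>h. 0)"
      using assms(2)[OF b] by (simp add: linear_cmul)
    then show ?thesis
      using has_derivative_compose[OF i assms(1)[OF b]] by simp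
  qed
  then obtain k where "\<And>x. x \<in> {0..1::real} \<Longrightarrow> f (p + x *\<^sub>R (s *\<^sub>R v)) = k"
    using has_derivative_zero_constant[of "{0..1::real}" "\<lambda>x. f (p + x *\<^sub>R (s *\<^sub>R v))"] by auto
  from this[of 0] this[of 1] show ?thesis by simp
qed

locale flag_equivalence =
  fixes c c' :: real and U :: "(real^17) set" and \<Phi> :: "real^17 \<Rightarrow> real^17"
    and J :: "real^17 \<Rightarrow> real^17 \<Rightarrow> real^17"
  assumes open_U: "open U" and zero_U: "0 \<in> U" and \<Phi>_0: "\<Phi> 0 = 0"
    and J: "\<And>p. p \<in> U \<Longrightarrow> (\<Phi> has_derivative J p) (at p)"
    and J_differentiable: "\<And>p v. p \<in> U \<Longrightarrow> (\<lambda>q. J q v) differentiable (at p)"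
    and inj_J: "\<And>p. p \<in> U \<Longrightarrow> inj (J p)"
    and J_flag_8: "\<And>p v. p \<in> U \<Longrightarrow> v \<in> flag c 8 p \<Longrightarrow> J p v \<in> flag c' 8 (\<Phi> p)"
begin

definition H :: "real^17 \<Rightarrow> real^17 \<Rightarrow> real^17 \<Rightarrow> real^17" where
  "H p v = frechet_derivative (\<lambda>q. J q v) (at p)"

lemma linear_J: "p \<in> U \<Longrightarrow> linear (J p)"
  using J has_derivative_linear by blast

lemma J_simps:
  assumes "p \<in> U"
  shows "J p 0 = 0" "J p (v + w) = J p v + J p w" "J p (v - w) = J p v - J p w"
    "J p (r *\<^sub>R v) = r *\<^sub>R J p v"
  using linear_J[OF assms] by (simp_all add: linear_0 linear_add linear_diff linear_cmul)

lemma coord_\<Phi>: "p \<in> U \<Longrightarrow> ((\<lambda>q. coord i (\<Phi> q)) has_derivative (\<lambda>v. coord i (J p v))) (at p)"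
  using bounded_linear.has_derivative[OF bounded_linear_coord J] by blast

lemma H: "p \<in> U \<Longrightarrow> ((\<lambda>q. J q v) has_derivative H p v) (at p)"
  unfolding H_def using J_differentiable frechet_derivative_works by blast

lemma coord_J: "p \<in> U \<Longrightarrow> ((\<lambda>q. coord i (J q v)) has_derivative (\<lambda>w. coord i (H p v w))) (at p)"
  using bounded_linear.has_derivative[OF bounded_linear_coord H] by blast

lemma H_commute: "p \<in> U \<Longrightarrow> coord i (H p v w) = coord i (H p w v)"
  using second_derivative_symmetric[OF open_U _ coord_\<Phi> coord_J coord_J] by blast

text \<open>The infinitesimal form of the statement that \<open>\<Phi>\<close> descends to the first
  \<open>2 * k + 1\<close> coordinates.\<close>

definition preserves_fib :: "nat \<Rightarrow> bool" where
  "preserves_fib k \<longleftrightarrow> (\<forall>p\<in>U. J p ` fib k \<subseteq> fib k)"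

definition preserves_flag :: "nat \<Rightarrow> bool" where
  "preserves_flag k \<longleftrightarrow> (\<forall>p\<in>U. J p ` flag c k p \<subseteq> flag c' k (\<Phi> p))"

lemma preserves_fibD: "preserves_fib k \<Longrightarrow> p \<in> U \<Longrightarrow> v \<in> fib k \<Longrightarrow> i \<le> 2 * k \<Longrightarrow> coord i (J p v) = 0"
  unfolding preserves_fib_def using fibD by blast

lemma preserves_flagD:
  "preserves_flag k \<Longrightarrow> p \<in> U \<Longrightarrow> v \<in> flag c k p \<Longrightarrow> J p v \<in> flag c' k (\<Phi> p)"
  unfolding preserves_flag_def by blast

lemma derivative_unique_on:
  fixes f g :: "real^17 \<Rightarrow> real"
  assumes "p \<in> U" "\<And>q. q \<in> U \<Longrightarrow> f q = g q"
    and "(f has_derivative f') (at p)" "(g has_derivative g') (at p)"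
  shows "f' v = g' v"
proof -
  have "(f has_derivative g') (at p)"
    using has_derivative_transform_within_open[OF assms(4) open_U assms(1)] assms(2) by metis
  then show ?thesis using has_derivative_unique assms(3) by blast
qed

text \<open>Differentiate the relation for \<open>v\<close> along \<open>w\<close> and the one for
  \<open>w\<close> along \<open>v\<close>. By symmetry of \<open>H\<close> the second-order terms
  agree, which leaves the products of first derivatives.\<close>

lemma symmetric_swap:
  assumes p: "p \<in> U"
    and v: "\<And>q. q \<in> U \<Longrightarrow> coord i (J q v) = (a + coord l (\<Phi> q)) * coord m (J q v)"
    and w: "\<And>q. q \<in> U \<Longrightarrow> coord i (J q w) = (a + coord l (\<Phi> q)) * coord m (J q w)"
  shows "coord l (J p w) * coord m (J p v) = coord l (J p v) * coord m (J p w)"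
proof -
  have *: "((\<lambda>q. (a + coord l (\<Phi> q)) * coord m (J q x)) has_derivative
      (\<lambda>h. (a + coord l (\<Phi> p)) * coord m (H p x h) + coord l (J p h) * coord m (J p x))) (at p)" for x
    by (rule derivative_eq_intros coord_\<Phi>[OF p] coord_J[OF p] | simp)+
  have "coord i (H p v w) = (a + coord l (\<Phi> p)) * coord m (H p v w) + coord l (J p w) * coord m (J p v)"
    using derivative_unique_on[OF p v coord_J[OF p] *] by blast
  moreover have "coord i (H p w v) = (a + coord l (\<Phi> p)) * coord m (H p w v) + coord l (J p v) * coord m (J p w)"
    using derivative_unique_on[OF p w coord_J[OF p] *] by blast
  ultimately show ?thesis using H_commute[OF p] by (metis add_left_cancel)
qed

text \<open>Some combination \<open>y\<close> of the two vertical vectors has an image without pivot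
  component. By \<open>symmetric_swap\<close> this image also lacks the components at
  \<open>2 * k + 1\<close> and \<open>2 * k + 2\<close>, so it lies in \<open>fib (Suc k)\<close>.
  Injectivity puts \<open>y\<close> there too, so its coefficients, the pivot components of the two
  images, vanish.\<close>

lemma preserves_fib_step:
  assumes k: "1 \<le> k" "k < 8" and fib: "preserves_fib (Suc k)" and flag: "preserves_flag (Suc k)"
  shows "preserves_fib k"
proof -
  define n where "n = pivot (Suc k)"
  let ?v = "E (2 * k + 1)" and ?w = "E (2 * k + 2)"
  have vw: "?v \<in> fib k" "?w \<in> fib k" using k by (auto intro: E_in_fib)
  have Jx: "J q x \<in> flag c' (Suc k) (\<Phi> q)" if "q \<in> U" "x \<in> fib k" for q x
    using preserves_flagD[OF flag that(1)] fib_subset_flag[of "Suc k" c q] that(2) by auto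
  have rel: "coord (partner k) (J q x) = (shift c' k + coord (2 * k + 1) (\<Phi> q)) * coord n (J q x)"
    "coord (2 * k) (J q x) = (0 + coord (2 * k + 2) (\<Phi> q)) * coord n (J q x)"
    if "q \<in> U" "x \<in> fib k" for q x
    using Jx[OF that] unfolding flag_Suc[OF k(1)] n_def by simp_all
  have J0: "coord n (J p x) = 0" if p: "p \<in> U" and x: "x \<in> {?v, ?w}" for p x
  proof -
    \<comment> \<open>a vertical direction whose image has no component at any position up to \<open>2 * Suc k\<close>\<close>
    define y where "y = coord n (J p ?w) *\<^sub>R ?v - coord n (J p ?v) *\<^sub>R ?w"
    have "y \<in> fib k" unfolding y_def using vw subspace_fib by (intro subspace_diff subspace_scale)
    moreover have "coord n (J p y) = 0" by (simp add: y_def J_simps[OF p])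
    ultimately have "J p y \<in> fib k"
      using flag_pivot_zero[OF _ Jx[OF p], of y] by (simp add: n_def)
    moreover have "coord (2 * k + 1) (J p y) = 0" "coord (2 * k + 2) (J p y) = 0"
      using symmetric_swap[OF p rel(1)[OF _ vw(1)] rel(1)[OF _ vw(2)]]
        symmetric_swap[OF p rel(2)[OF _ vw(1)] rel(2)[OF _ vw(2)]]
      by (simp_all add: y_def J_simps[OF p] mult.commute)
    ultimately have "coord i (J p y) = 0" if "i \<le> 2 * Suc k" for i
    proof -
      have "i \<le> 2 * k \<or> i = 2 * k + 1 \<or> i = 2 * k + 2" using that by auto
      then show ?thesis
        using fibD[OF \<open>J p y \<in> fib k\<close>] \<open>coord (2 * k + 1) (J p y) = 0\<close> \<open>coord (2 * k + 2) (J p y) = 0\<close>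
        by blast
    qed
    then have "J p y \<in> fib (Suc k)" by (simp add: fib_def)
    then have "y \<in> fib (Suc k)"
      using inj_invariant_subspace[OF linear_J[OF p] inj_J[OF p] subspace_fib] fib p
      unfolding preserves_fib_def by blast
    then have "coord (2 * k + 1) y = 0" "coord (2 * k + 2) y = 0" by (auto intro: fibD)
    then have "coord n (J p ?w) = 0" "coord n (J p ?v) = 0"
      using k unfolding y_def by (simp_all add: coord_E)
    then show ?thesis using x by blast
  qed
  show ?thesis
    unfolding preserves_fib_def
  proof (intro ballI subsetI, elim imageE)
    fix p z x assume p: "p \<in> U" and z: "z = J p x" and x: "x \<in> fib k"
    define x' where "x' = x - coord (2 * k + 1) x *\<^sub>R ?v - coord (2 * k + 2) x *\<^sub>R ?w"
    have x': "x' \<in> fib (Suc k)" using fib_reduce[of "Suc k" x] k x by (simp add: x'_def)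
    have n: "n \<le> 2 * Suc k" using pivot_le[of k] by (simp add: n_def)
    have "x = x' + coord (2 * k + 1) x *\<^sub>R ?v + coord (2 * k + 2) x *\<^sub>R ?w" by (simp add: x'_def)
    then have "coord n (J p x) = coord n (J p (x' + coord (2 * k + 1) x *\<^sub>R ?v + coord (2 * k + 2) x *\<^sub>R ?w))"
      by simp
    also have "\<dots> = 0"
      using J0[OF p] preserves_fibD[OF fib p x' n] by (simp add: J_simps[OF p])
    finally show "z \<in> fib k"
      using flag_pivot_zero[OF _ Jx[OF p x]] by (simp add: n_def z)
  qed
qed

text \<open>For vertical \<open>v\<close> the low components of \<open>J q v\<close> vanish
  identically in \<open>q\<close>, hence so do those of \<open>H q v w = H q w v\<close>, the
  derivative of \<open>J q w\<close> along \<open>v\<close>.\<close>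

lemma constant_along_fib:
  assumes k: "preserves_fib k" and p: "p \<in> U"
  shows "\<exists>\<epsilon>>0. \<forall>v s. v \<in> fib k \<longrightarrow> norm v = 1 \<longrightarrow> \<bar>s\<bar> < \<epsilon> \<longrightarrow> p + s *\<^sub>R v \<in> U \<and>
    (\<forall>i\<le>2 * k. coord i (\<Phi> (p + s *\<^sub>R v)) = coord i (\<Phi> p) \<and>
      (\<forall>w. coord i (J (p + s *\<^sub>R v) w) = coord i (J p w)))"
proof -
  obtain \<epsilon> where e: "\<epsilon> > 0" "ball p \<epsilon> \<subseteq> U" using open_U p openE by blast
  have H0: "coord i (H q w v) = 0" if "v \<in> fib k" "i \<le> 2 * k" "q \<in> U" for v w i q
  proof -
    have "coord i (H q v w) = (0::real)"
      by (rule derivative_unique_on[OF that(3) _ coord_J[OF that(3)] has_derivative_const[of 0]])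
        (use preserves_fibD[OF k] that in simp)
    then show ?thesis using H_commute that by simp
  qed
  show ?thesis
  proof (intro exI[of _ \<epsilon>] conjI[OF e(1)] allI impI conjI)
    fix v s i assume v: "v \<in> fib k" "norm v = 1" "\<bar>s\<bar> < \<epsilon>"
    show "p + s *\<^sub>R v \<in> U" using e v by (auto simp: subset_iff dist_norm)
    assume i: "i \<le> 2 * k"
    have n: "norm (s *\<^sub>R v) < \<epsilon>" using v by simp
    show "coord i (\<Phi> (p + s *\<^sub>R v)) = coord i (\<Phi> p)"
      by (rule constant_on_segment[OF coord_\<Phi> _ n]) (use e v i preserves_fibD[OF k] in auto)
    show "coord i (J (p + s *\<^sub>R v) w) = coord i (J p w)" for w
      by (rule constant_on_segment[OF coord_J _ n]) (use e v i H0 in auto)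
  qed
qed

lemma preserves_flag_step:
  assumes k: "1 \<le> k" "k < 8" and fib: "preserves_fib k" and flag: "preserves_flag (Suc k)"
  shows "preserves_flag k"
  unfolding preserves_flag_def
proof (intro ballI subsetI, elim imageE)
  fix p z x assume p: "p \<in> U" and z: "z = J p x" and x: "x \<in> flag c k p"
  obtain \<epsilon> where "\<epsilon> > 0" and
    \<epsilon>: "\<forall>v s. v \<in> fib k \<longrightarrow> norm v = 1 \<longrightarrow> \<bar>s\<bar> < \<epsilon> \<longrightarrow> p + s *\<^sub>R v \<in> U \<and>
    (\<forall>i\<le>2 * k. coord i (\<Phi> (p + s *\<^sub>R v)) = coord i (\<Phi> p) \<and>
      (\<forall>w. coord i (J (p + s *\<^sub>R v) w) = coord i (J p w)))"
    using constant_along_fib[OF fib p] by blast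
  have e: "\<epsilon> > 0"
    "\<And>v s. v \<in> fib k \<Longrightarrow> norm v = 1 \<Longrightarrow> \<bar>s\<bar> < \<epsilon> \<Longrightarrow> p + s *\<^sub>R v \<in> U"
    "\<And>v s i. v \<in> fib k \<Longrightarrow> norm v = 1 \<Longrightarrow> \<bar>s\<bar> < \<epsilon> \<Longrightarrow> i \<le> 2 * k \<Longrightarrow>
        coord i (\<Phi> (p + s *\<^sub>R v)) = coord i (\<Phi> p)"
    "\<And>v w s i. v \<in> fib k \<Longrightarrow> norm v = 1 \<Longrightarrow> \<bar>s\<bar> < \<epsilon> \<Longrightarrow> i \<le> 2 * k \<Longrightarrow>
        coord i (J (p + s *\<^sub>R v) w) = coord i (J p w)"
    using \<open>\<epsilon> > 0\<close> \<epsilon> by blast+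
  \<comment> \<open>As \<open>\<Phi>\<close> and \<open>J\<close> are constant along the fibre up to vertical terms, \<open>M\<close> contains the planes \<open>flag c (Suc k)\<close>
    at all nearby points of the fibre, hence their differences.\<close>
  define M where "M = {v. J p v \<in> flag c' k (\<Phi> p)}"
  have M: "subspace M"
    unfolding M_def using linear_subspace_vimage[OF linear_J[OF p] subspace_flag] by (simp add: vimage_def)
  have near: "v \<in> M" if "y \<in> fib k" "norm y = 1" "\<bar>s\<bar> < \<epsilon>" "v \<in> flag c (Suc k) (p + s *\<^sub>R y)" for y s v
  proof -
    have "J (p + s *\<^sub>R y) v \<in> flag c' (Suc k) (\<Phi> (p + s *\<^sub>R y))"
      using preserves_flagD[OF flag e(2)] that by blast
    then have *: "J (p + s *\<^sub>R y) v \<in> flag c' k (\<Phi> (p + s *\<^sub>R y))"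
      using flag_Suc[OF k(1)] by blast
    show ?thesis unfolding M_def mem_Collect_eq
      by (rule flag_cong[OF _ _ *]) (use e(3,4)[OF that(1-3)] in auto)
  qed
  define s where "s = \<epsilon> / 2"
  have s: "\<bar>s\<bar> < \<epsilon>" "s \<noteq> 0" using e(1) by (auto simp: s_def)
  let ?v = "E (2 * k + 1)" and ?w = "E (2 * k + 2)"
  have vw: "?v \<in> fib k" "?w \<in> fib k" using k by (auto intro: E_in_fib)
  have gM: "gen c (Suc k) (p + r *\<^sub>R y) \<in> M" if "y \<in> {?v, ?w}" "\<bar>r\<bar> < \<epsilon>" for y r
    using near[of y r, OF _ _ that(2) gen_in_flag] vw k that(1) by (auto simp: norm_E)
  have g0: "gen c (Suc k) p \<in> M" using gM[of ?v 0] e(1) by simp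
  have gk: "gen c k (p + s *\<^sub>R y) = gen c k p" if "y \<in> {?v, ?w}" for y
    by (rule gen_cong) (use fibD vw that in auto)
  \<comment> \<open>The generator is affine in \<open>x\<^sub>k\<^sub>+\<^sub>1\<close> and
    \<open>y\<^sub>k\<^sub>+\<^sub>1\<close>, so a finite displacement along the fibre isolates each
    coefficient vector exactly.\<close>
  have gw: "gen c (Suc k) (p + s *\<^sub>R ?w) = gen c (Suc k) p + s *\<^sub>R E (2 * k)"
    using gk[of ?w] k by (simp add: coord_E algebra_simps)
  have gv: "gen c (Suc k) (p + s *\<^sub>R ?v) = gen c (Suc k) p + s *\<^sub>R (if even k then gen c k p else E (2 * k - 1))"
    using gk[of ?v] k by (simp add: coord_E algebra_simps)
  have *: "y \<in> M" if "a + s *\<^sub>R y \<in> M" "a \<in> M" for a y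
  proof -
    have "inverse s *\<^sub>R ((a + s *\<^sub>R y) - a) \<in> M"
      using M that by (intro subspace_scale subspace_diff)
    then show ?thesis using s by simp
  qed
  have M1: "E (2 * k) \<in> M" using *[OF _ g0, of "E (2 * k)"] gM[of ?w s] s gw by simp
  have M2: "(if even k then gen c k p else E (2 * k - 1)) \<in> M"
    using *[OF _ g0, of "if even k then gen c k p else E (2 * k - 1)"] gM[of ?v s] s gv by simp
  \<comment> \<open>The vector not yet found is what remains of \<open>gen c (Suc k) p\<close> after
    the known terms are subtracted.\<close>
  have M3: "E (2 * k - 1) \<in> M \<and> gen c k p \<in> M"
  proof (cases "even k")
    case True
    have "gen c (Suc k) p - coord (2 * k + 2) p *\<^sub>R E (2 * k) - coord (2 * k + 1) p *\<^sub>R gen c k p \<in> M"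
      using g0 M1 M2 True M by (auto intro!: subspace_diff subspace_scale simp del: gen.simps)
    moreover have "gen c (Suc k) p - coord (2 * k + 2) p *\<^sub>R E (2 * k) - coord (2 * k + 1) p *\<^sub>R gen c k p
      = E (2 * k - 1)" using True k by simp
    ultimately show ?thesis using M2 True by simp
  next
    case False
    have "gen c (Suc k) p - coord (2 * k + 2) p *\<^sub>R E (2 * k)
        - (shift c k + coord (2 * k + 1) p) *\<^sub>R E (2 * k - 1) \<in> M"
      using g0 M1 M2 False M by (auto intro!: subspace_diff subspace_scale simp del: gen.simps)
    moreover have "gen c (Suc k) p - coord (2 * k + 2) p *\<^sub>R E (2 * k)
        - (shift c k + coord (2 * k + 1) p) *\<^sub>R E (2 * k - 1) = gen c k p" using False k by simp
    ultimately show ?thesis using M2 False by simp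
  qed
  have fibM: "fib k \<subseteq> M"
  proof
    fix y assume "y \<in> fib k"
    then have "J p y \<in> fib k" using fib p unfolding preserves_fib_def by blast
    then have "J p y \<in> fib (k - 1)" by (auto simp: fib_def)
    then show "y \<in> M" using fib_subset_flag unfolding M_def by blast
  qed
  define f where "f = x - coord (pivot k) x *\<^sub>R gen c k p"
  define f' where "f' = f - coord (2 * k - 1) f *\<^sub>R E (2 * k - 1) - coord (2 * k) f *\<^sub>R E (2 * k)"
  have "f \<in> fib (k - 1)" unfolding f_def using flag_minus_gen[OF _ _ x] k by simp
  then have "f' \<in> M" using fib_reduce[of k f] k fibM unfolding f'_def by auto
  then have "f' + coord (2 * k - 1) f *\<^sub>R E (2 * k - 1) + coord (2 * k) f *\<^sub>R E (2 * k)
      + coord (pivot k) x *\<^sub>R gen c k p \<in> M"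
    using M M1 M3 by (intro subspace_add subspace_scale) auto
  then have "x \<in> M" by (simp add: f'_def f_def)
  then show "z \<in> flag c' k (\<Phi> p)" by (simp add: M_def z)
qed

text \<open>Descending induction from level 8, where the vertical space is zero. At each level the
  fibre step precedes the flag step, which uses its result.\<close>

lemma preserves:
  assumes "1 \<le> k" "k \<le> 8"
  shows "preserves_fib k \<and> preserves_flag k"
  using assms(2,1)
proof (induction k rule: inc_induct)
  case base
  have "fib 8 = {0}"
  proof -
    have "v = 0" if "v \<in> fib 8" for v
      by (rule coord_eqI) (use fibD[OF that] in simp)
    then show ?thesis by (auto simp: fib_def)
  qed
  then show ?case
    unfolding preserves_fib_def preserves_flag_def image_subset_iff
    using J_simps(1) J_flag_8 by simp
next
  case (step k)
  then show ?case using preserves_fib_step preserves_flag_step by auto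
qed

end


section \<open>Relations between derivatives at the origin\<close>

text \<open>Since \<open>f\<close> vanishes at \<open>x\<close>, a change of \<open>g\<close> enters
  only multiplied by a quantity of first order, so continuity of \<open>g\<close> replaces
  differentiability in the product rule.\<close>

lemma has_derivative_mult_continuous_at_zero:
  fixes f g :: "'a::real_normed_vector \<Rightarrow> real"
  assumes f: "(f has_derivative f') (at x)" "f x = 0" and g: "continuous (at x) g"
  shows "((\<lambda>y. f y * g y) has_derivative (\<lambda>h. f' h * g x)) (at x)"
proof -
  interpret f': bounded_linear f' using f(1) by (rule has_derivative_bounded_linear)
  define r where "r = (\<lambda>h. (f (x + h) - f x - f' h) / norm h)"
  obtain K where K: "K > 0" "\<And>h. norm (f' h) \<le> norm h * K" using f'.pos_bounded by blast
  have r: "r \<midarrow>0\<rightarrow> 0"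
    using f(1) unfolding has_derivative_at r_def by (subst tendsto_norm_zero_iff[symmetric]) simp
  have gl: "((\<lambda>h. g (x + h)) \<longlongrightarrow> g x) (at 0)"
    using g unfolding isCont_def by (rule LIM_offset_zero)
  then have g0: "((\<lambda>h. g (x + h) - g x) \<longlongrightarrow> 0) (at 0)"
    by (rule LIM_zero)
  have fb: "((\<lambda>h. (f' h / norm h) * (g (x + h) - g x)) \<longlongrightarrow> 0) (at 0)"
  proof (rule Lim_null_comparison)
    show "\<forall>\<^sub>F h in at 0. norm (f' h / norm h * (g (x + h) - g x)) \<le> K * \<bar>g (x + h) - g x\<bar>"
    proof (rule always_eventually, rule allI)
      fix h
      have "\<bar>f' h\<bar> / norm h \<le> K"
        using K(1) K(2)[of h] by (cases "h = 0") (auto simp: divide_le_eq mult.commute)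
      then show "norm (f' h / norm h * (g (x + h) - g x)) \<le> K * \<bar>g (x + h) - g x\<bar>"
        using mult_right_mono[of "\<bar>f' h\<bar> / norm h" K "\<bar>g (x + h) - g x\<bar>"] by (simp add: abs_mult)
    qed
    show "((\<lambda>h. K * \<bar>g (x + h) - g x\<bar>) \<longlongrightarrow> 0) (at 0)"
      using tendsto_mult_right_zero[OF tendsto_rabs_zero[OF g0], of K] by simp
  qed
  have "((\<lambda>h. r h * g (x + h) + (f' h / norm h) * (g (x + h) - g x)) \<longlongrightarrow> 0) (at 0)"
    using tendsto_add[OF tendsto_mult[OF r gl] fb] by simp
  moreover have "r h * g (x + h) + (f' h / norm h) * (g (x + h) - g x)
      = (f (x + h) * g (x + h) - f x * g x - f' h * g x) / norm h" for h
    using f(2) by (cases "h = 0") (simp_all add: r_def field_simps)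
  ultimately show ?thesis
    unfolding has_derivative_at
    by (auto intro!: bounded_linear_intros f'.bounded_linear_axioms simp: tendsto_norm_zero_iff
        dest: tendsto_norm_zero)
qed

section \<open>Multipliers of the generators and the resulting equations at the origin\<close>

context flag_equivalence
begin

text \<open>The factor by which \<open>J p\<close> scales the generator: on \<open>U\<close>, for
  \<open>k\<close> from 1 to 8, the image of \<open>gen c k p\<close> is \<open>z k p\<close> times
  \<open>gen c' k (\<Phi> p)\<close> modulo \<open>fib (k - 1)\<close>.\<close>

definition z :: "nat \<Rightarrow> real^17 \<Rightarrow> real" where
  "z k p = coord (pivot k) (J p (gen c k p))"

definition e :: "nat \<Rightarrow> real" where
  "e k = coord (2 * k - 1) (J 0 (E (2 * k - 1)))"

lemma J_E_zero:
  assumes "1 \<le> k" "k \<le> 8" "p \<in> U" "2 * k < j" "j < 17" "i \<le> 2 * k"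
  shows "coord i (J p (E j)) = 0"
  using preserves[OF assms(1,2)] preserves_fibD[OF _ assms(3) E_in_fib[OF assms(4,5)] assms(6)] by blast

lemma isCont_z:
  assumes "k \<le> 8"
  shows "isCont (z k) 0"
proof -
  have J: "isCont (\<lambda>p. coord i (J p v)) 0" for i v
    using coord_J[OF zero_U] has_derivative_continuous by blast
  have co: "isCont (coord i) 0" for i
    by (rule linear_continuous_at[OF bounded_linear_coord])
  \<comment> \<open>The claim is proved for every position \<open>i\<close>, because the pivot
    changes during the recursion.\<close>
  have "isCont (\<lambda>p. coord i (J p (gen c k p))) 0" for i
  proof (induction k)
    case 0
    then show ?case using J by simp
  next
    case (Suc k)
    have "\<forall>\<^sub>F p in nhds 0. p \<in> U" using open_U zero_U eventually_nhds_in_open by blast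
    then have ev: "\<forall>\<^sub>F p in nhds 0. coord i (J p (gen c (Suc k) p)) =
      (if k = 0 then coord i (J p (E 0))
      else if even k then coord i (J p (E (2 * k - 1))) + coord (2 * k + 2) p * coord i (J p (E (2 * k)))
        + coord (2 * k + 1) p * coord i (J p (gen c k p))
      else (shift c k + coord (2 * k + 1) p) * coord i (J p (E (2 * k - 1)))
        + coord (2 * k + 2) p * coord i (J p (E (2 * k))) + coord i (J p (gen c k p)))"
      by eventually_elim (simp add: J_simps)
    have "isCont (\<lambda>p. if k = 0 then coord i (J p (E 0))
      else if even k then coord i (J p (E (2 * k - 1))) + coord (2 * k + 2) p * coord i (J p (E (2 * k)))
        + coord (2 * k + 1) p * coord i (J p (gen c k p))
      else (shift c k + coord (2 * k + 1) p) * coord i (J p (E (2 * k - 1)))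
        + coord (2 * k + 2) p * coord i (J p (E (2 * k))) + coord i (J p (gen c k p))) 0"
      using J co Suc by (cases "k = 0"; cases "even k") (simp_all del: One_nat_def)
    then show ?case using isCont_cong[OF ev] by blast
  qed
  then show ?thesis unfolding z_def .
qed

lemma flag_relation:
  assumes k: "1 \<le> k" "k < 8" and p: "p \<in> U"
  shows "coord (partner k) (J p (gen c (Suc k) p)) = (shift c' k + coord (2 * k + 1) (\<Phi> p)) * z (Suc k) p"
proof -
  have "J p (gen c (Suc k) p) \<in> flag c' (Suc k) (\<Phi> p)"
    using preserves_flagD[OF _ p gen_in_flag] preserves[of "Suc k"] k by (simp del: gen.simps)
  then show ?thesis unfolding flag_Suc[OF k(1)] z_def by blast
qed

text \<open>For even \<open>k\<close> the partner is \<open>pivot k\<close>. The terms along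
  \<open>E (2 * k - 1)\<close> and \<open>E (2 * k)\<close> map into \<open>fib (k - 1)\<close> and
  have no component there, so only the multiple of \<open>gen c k p\<close> contributes.\<close>

lemma even_relation:
  assumes k: "2 \<le> k" "k < 8" "even k" and p: "p \<in> U"
  shows "coord (2 * k + 1) p * z k p = coord (2 * k + 1) (\<Phi> p) * z (Suc k) p"
proof -
  have "coord (pivot k) (J p (E (2 * k - 1))) = 0" "coord (pivot k) (J p (E (2 * k))) = 0"
    using k p pivot_le'[of k] by (auto intro!: J_E_zero[of "k - 1"])
  then have "coord (partner k) (J p (gen c (Suc k) p)) = coord (2 * k + 1) p * z k p"
    using k p by (simp add: partner_def J_simps z_def)
  then show ?thesis using flag_relation[of k p] k p by simp
qed

text \<open>For odd \<open>k\<close> the pivot stays and the two added vectors map into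
  \<open>fib (k - 1)\<close>, so the multiplier is unchanged; the partner is now
  \<open>x\<^sub>k\<close>.\<close>

lemma odd_relation:
  assumes k: "2 \<le> k" "k < 8" "odd k" and p: "p \<in> U"
  shows "(shift c k + coord (2 * k + 1) p) * coord (2 * k - 1) (J p (E (2 * k - 1)))
      + coord (2 * k + 2) p * coord (2 * k - 1) (J p (E (2 * k))) + coord (2 * k - 1) (J p (gen c k p))
      = (shift c' k + coord (2 * k + 1) (\<Phi> p)) * z k p"
    and "z (Suc k) p = z k p"
proof -
  have "coord (pivot k) (J p (E (2 * k - 1))) = 0" "coord (pivot k) (J p (E (2 * k))) = 0"
    using k p pivot_le'[of k] by (auto intro!: J_E_zero[of "k - 1"])
  then show *: "z (Suc k) p = z k p"
    using k p by (simp add: J_simps z_def)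
  show "(shift c k + coord (2 * k + 1) p) * coord (2 * k - 1) (J p (E (2 * k - 1)))
      + coord (2 * k + 2) p * coord (2 * k - 1) (J p (E (2 * k))) + coord (2 * k - 1) (J p (gen c k p))
      = (shift c' k + coord (2 * k + 1) (\<Phi> p)) * z k p"
    using flag_relation[of k p] k p * by (simp add: partner_def J_simps)
qed

text \<open>Otherwise \<open>gen c k p\<close> would map into \<open>fib (k - 1)\<close> and by
  injectivity lie in it, although its pivot component is 1.\<close>

lemma z_nonzero:
  assumes k: "2 \<le> k" "k \<le> 8" and p: "p \<in> U"
  shows "z k p \<noteq> 0"
proof
  assume "z k p = 0"
  then have "J p (gen c k p) \<in> fib (k - 1)"
    using preserves_flagD[OF _ p gen_in_flag, of k] preserves[of k] k
    by (intro flag_pivot_zero[of k _ c' "\<Phi> p"]) (auto simp: z_def)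
  moreover have "J p ` fib (k - 1) \<subseteq> fib (k - 1)"
    using preserves[of "k - 1"] k p unfolding preserves_fib_def by auto
  ultimately have "gen c k p \<in> fib (k - 1)"
    using inj_invariant_subspace[OF linear_J[OF p] inj_J[OF p] subspace_fib] by blast
  moreover have "pivot k \<le> 2 * (k - 1)" using pivot_le'[of k] k by (simp add: diff_mult_distrib2)
  ultimately show False using coord_pivot_gen[of k c p] fibD k by fastforce
qed

lemma gen_0_even:
  assumes "2 \<le> k" "even k"
  shows "gen c (Suc k) 0 = E (2 * k - 1)"
  using assms by simp

lemma z_Suc_even:
  assumes "2 \<le> k" "even k"
  shows "z (Suc k) 0 = e k"
  using assms by (simp add: z_def e_def)

text \<open>This is the derivative of \<open>even_relation\<close> at the origin; on both sides the
  first factor vanishes there, so the multipliers need only be continuous.\<close>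

lemma even_derivative:
  assumes k: "2 \<le> k" "k < 8" "even k"
  shows "coord (2 * k + 1) v * z k 0 = coord (2 * k + 1) (J 0 v) * e k"
proof -
  have 1: "((\<lambda>p. coord (2 * k + 1) p * z k p) has_derivative (\<lambda>h. coord (2 * k + 1) h * z k 0)) (at 0)"
    using k by (intro has_derivative_mult_continuous_at_zero isCont_z
        bounded_linear_imp_has_derivative bounded_linear_coord) auto
  have 2: "((\<lambda>p. coord (2 * k + 1) (\<Phi> p) * z (Suc k) p)
      has_derivative (\<lambda>h. coord (2 * k + 1) (J 0 h) * z (Suc k) 0)) (at 0)"
    using k zero_U by (intro has_derivative_mult_continuous_at_zero isCont_z coord_\<Phi>) (auto simp: \<Phi>_0)
  show ?thesis
    using derivative_unique_on[OF zero_U even_relation[OF k] 1 2, of v] z_Suc_even[of k] k by simp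
qed

lemma e_nonzero: "2 \<le> k \<Longrightarrow> k < 8 \<Longrightarrow> even k \<Longrightarrow> e k \<noteq> 0"
  using z_nonzero[of "Suc k" 0] z_Suc_even[of k] zero_U by simp

lemma z_even:
  assumes "2 \<le> k" "k < 8" "even k"
  shows "z k 0 = e (Suc k) * e k"
  using even_derivative[OF assms, of "E (2 * k + 1)"] assms by (simp add: coord_E e_def)

text \<open>At the origin \<open>gen c k 0\<close> is the direction of
  \<open>x\<^sub>k\<^sub>-\<^sub>1\<close>, and by \<open>even_derivative\<close> one level down its
  image has no \<open>x\<^sub>k\<close> component. So \<open>odd_relation\<close> keeps only the
  shift terms.\<close>

lemma odd_at_0:
  assumes k: "3 \<le> k" "k < 8" "odd k"
  shows "shift c k * e k = shift c' k * e (k - 1)"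
proof -
  obtain m where m: "k = Suc m" "even m" "2 \<le> m" "m < 8" using k by (cases k) auto
  have "coord (2 * m + 1) (J 0 (E (2 * m - 1))) = 0"
  proof -
    have "2 * m + 1 \<noteq> 2 * m - 1" by arith
    then have "coord (2 * m + 1) (E (2 * m - 1)) = 0" using coord_E[of "2 * m + 1" "2 * m - 1"] m by simp
    then show ?thesis
      using even_derivative[OF m(3,4,2), of "E (2 * m - 1)"] e_nonzero[OF m(3,4,2)] by simp
  qed
  then show ?thesis
    using odd_relation(1)[of k 0] zero_U k z_Suc_even[of m] gen_0_even[of m] m
    by (simp add: \<Phi>_0 e_def del: gen.simps)
qed

text \<open>Along the fibre direction \<open>x\<^sub>k\<^sub>+\<^sub>1\<close> the multiplier, the
  generator and the low components of \<open>J\<close> are constant. In \<open>odd_relation\<close>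
  only \<open>x\<^sub>k\<^sub>+\<^sub>1\<close> and the corresponding component of
  \<open>\<Phi>\<close> vary.\<close>

lemma odd_derivative:
  assumes k: "3 \<le> k" "k < 7" "odd k"
  shows "e k = e (Suc k) * e (k - 1)"
proof -
  let ?v = "E (2 * k + 1)"
  have z: "z k 0 = e (k - 1)" using z_Suc_even[of "k - 1"] k by (cases k) auto
  have fib: "?v \<in> fib k" "preserves_fib k" using k preserves by (auto intro: E_in_fib)
  obtain \<epsilon> where "\<epsilon> > 0" and \<epsilon>: "\<And>s. \<bar>s\<bar> < \<epsilon> \<Longrightarrow> s *\<^sub>R ?v \<in> U"
    "\<And>s i w. \<bar>s\<bar> < \<epsilon> \<Longrightarrow> i \<le> 2 * k \<Longrightarrow> coord i (J (s *\<^sub>R ?v) w) = coord i (J 0 w)"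
    using constant_along_fib[OF fib(2) zero_U] fib(1) norm_E[of "2 * k + 1"] by (metis add_0)
  have g: "gen c k (s *\<^sub>R ?v) = gen c k 0" for s
    by (rule gen_cong) (use fibD[OF fib(1)] in simp)
  \<comment> \<open>Subtracting the relation at 0 from the one at \<open>s *\<^sub>R ?v\<close>
    cancels the shifts and the generator term.\<close>
  have *: "coord (2 * k + 1) (\<Phi> (s *\<^sub>R ?v)) * e (k - 1) = s * e k" if s: "\<bar>s\<bar> < \<epsilon>" for s
  proof -
    have zs: "z k (s *\<^sub>R ?v) = e (k - 1)"
      using \<epsilon>(2)[OF s, of "pivot k"] pivot_le'[of k] k z g[of s] by (simp add: z_def)
    have "coord (2 * k + 1) (s *\<^sub>R ?v) = s" "coord (2 * k + 2) (s *\<^sub>R ?v) = 0"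
      using k by (simp_all add: coord_E)
    then have "(shift c k + s) * e k + coord (2 * k - 1) (J 0 (gen c k 0))
        = (shift c' k + coord (2 * k + 1) (\<Phi> (s *\<^sub>R ?v))) * e (k - 1)"
      using odd_relation(1)[OF _ _ k(3) \<epsilon>(1)[OF s]] k \<epsilon>(2)[OF s, of "2 * k - 1"] zs g[of s]
      by (simp only: e_def) simp
    moreover have "shift c k * e k + coord (2 * k - 1) (J 0 (gen c k 0)) = shift c' k * e (k - 1)"
      using odd_relation(1)[OF _ _ k(3) zero_U] k z by (simp add: e_def \<Phi>_0)
    ultimately show ?thesis by (simp add: algebra_simps)
  qed
  have "((\<lambda>s. s *\<^sub>R ?v) has_derivative (\<lambda>h. h *\<^sub>R ?v)) (at (0::real))"
    by (auto intro!: derivative_eq_intros)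
  moreover have "((\<lambda>q. coord (2 * k + 1) (\<Phi> q)) has_derivative (\<lambda>w. coord (2 * k + 1) (J 0 w))) (at (0 *\<^sub>R ?v))"
    using coord_\<Phi>[OF zero_U, of "2 * k + 1"] by simp
  ultimately have "((\<lambda>s. coord (2 * k + 1) (\<Phi> (s *\<^sub>R ?v))) has_derivative (\<lambda>h. coord (2 * k + 1) (J 0 (h *\<^sub>R ?v)))) (at 0)"
    by (rule has_derivative_compose)
  then have "((\<lambda>s. coord (2 * k + 1) (\<Phi> (s *\<^sub>R ?v)) * e (k - 1)) has_derivative
      (\<lambda>h. coord (2 * k + 1) (J 0 (h *\<^sub>R ?v)) * e (k - 1))) (at 0)"
    by (rule has_derivative_mult_left)
  moreover have "((\<lambda>s. coord (2 * k + 1) (\<Phi> (s *\<^sub>R ?v)) * e (k - 1)) has_derivative (\<lambda>h. h * e k)) (at 0)"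
  proof (rule has_derivative_transform_within[of _ _ _ _ \<epsilon>])
    show "((\<lambda>s. s * e k) has_derivative (\<lambda>h. h * e k)) (at 0)" by (auto intro!: derivative_eq_intros)
  qed (use * \<open>\<epsilon> > 0\<close> in \<open>auto simp: dist_real_def\<close>)
  ultimately have "(\<lambda>h. coord (2 * k + 1) (J 0 (h *\<^sub>R ?v)) * e (k - 1)) = (\<lambda>h. h * e k)"
    by (rule has_derivative_unique)
  from fun_cong[OF this, of 1] show ?thesis by (simp add: e_def)
qed

lemma parameters_eq: "c = c'"
proof -
  have nz: "e 2 \<noteq> 0" "e 4 \<noteq> 0" "e 6 \<noteq> 0" by (simp_all add: e_nonzero)
  have z: "z 4 0 = e 2" "z 6 0 = e 4"
    using odd_relation(2)[of 3 0] odd_relation(2)[of 5 0] z_Suc_even[of 2] z_Suc_even[of 4] zero_U by simp_all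
  have "e 2 = e 5 * e 4" "e 4 = e 7 * e 6" using z z_even[of 4] z_even[of 6] by simp_all
  moreover have "e 3 = e 2" "e 5 = e 4" "c * e 7 = c' * e 6"
    using odd_at_0[of 3] odd_at_0[of 5] odd_at_0[of 7] by (simp_all add: shift_def)
  moreover have "e 3 = e 4 * e 2" "e 5 = e 6 * e 4"
    using odd_derivative[of 3] odd_derivative[of 5] by simp_all
  \<comment> \<open>The two values of \<open>e 3\<close> give \<open>e 4 = 1\<close>, those of
    \<open>e 5\<close> give \<open>e 6 = 1\<close>, and then \<open>e 4 = e 7 * e 6\<close> gives
    \<open>e 7 = 1\<close>.\<close>
  ultimately have "e 4 = 1" "e 6 = 1" "e 7 = 1" "c * e 7 = c' * e 6" using nz by auto
  then show ?thesis by simp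
qed

end


section \<open>From germ equivalence to the infinitesimal setting\<close>

lemma germ_equivalent_smooth_imp_eq:
  assumes "germ_equivalent smooth_on (D c) (D c')"
  shows "c = c'"
proof -
  obtain U V \<Phi> \<Psi> where open_U: "open U" and "open V" and zero: "0 \<in> U" "\<Phi> 0 = 0"
    and hom: "homeomorphism U V \<Phi> \<Psi>" and smooth: "smooth_on U \<Phi>" "smooth_on V \<Psi>"
    and push: "\<And>q. q \<in> V \<Longrightarrow> pushforward \<Phi> \<Psi> (D c) q = D c' q"
    using assms unfolding germ_equivalent_def by blast
  define J where "J p = frechet_derivative \<Phi> (at p)" for p
  have C2: "Ck_on 2 U \<Phi>" and C1: "Ck_on 1 V \<Psi>"
    using smooth unfolding smooth_on_def by blast+
  have J: "(\<Phi> has_derivative J p) (at p)" if "p \<in> U" for p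
    using C2 that frechet_derivative_works unfolding J_def numeral_2_eq_2 by auto
  have J_diff: "(\<lambda>q. J q v) differentiable (at p)" if "p \<in> U" for p v
    using C2 that unfolding J_def numeral_2_eq_2 by auto
  have \<Psi>: "\<Psi> differentiable (at q)" if "q \<in> V" for q
    using C1 that by simp
  have maps: "\<Phi> p \<in> V" "\<Psi> (\<Phi> p) = p" if "p \<in> U" for p
    using hom that unfolding homeomorphism_def by auto
  have "flag_equivalence c c' U \<Phi> J"
  proof
    \<comment> \<open>Differentiating \<open>\<Psi> (\<Phi> q) = q\<close> shows that the derivative
      of \<open>\<Psi>\<close> is a left inverse of \<open>J p\<close>.\<close>
    show "inj (J p)" if p: "p \<in> U" for p
    proof -
      obtain K where K: "(\<Psi> has_derivative K) (at (\<Phi> p))"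
        using \<Psi>[OF maps(1)[OF p]] unfolding differentiable_def by blast
      have 1: "((\<lambda>q. \<Psi> (\<Phi> q)) has_derivative (\<lambda>v. K (J p v))) (at p)"
        by (rule has_derivative_compose[OF J[OF p] K])
      have 2: "((\<lambda>q. \<Psi> (\<Phi> q)) has_derivative (\<lambda>v. v)) (at p)"
        by (rule has_derivative_transform_within_open[OF has_derivative_ident open_U p])
          (simp add: maps)
      have "K (J p v) = v" for v
        using fun_cong[OF has_derivative_unique[OF 1 2]] .
      then show ?thesis by (rule inj_on_inverseI)
    qed
    show "J p v \<in> flag c' 8 (\<Phi> p)" if p: "p \<in> U" and v: "v \<in> flag c 8 p" for p v
      using push[OF maps(1)[OF p]] v unfolding pushforward_def maps(2)[OF p] D_eq_flag J_def by blast
  qed (use open_U zero J J_diff in auto)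
  then show ?thesis by (rule flag_equivalence.parameters_eq)
qed

theorem mainTheorem7:
  fixes c c' :: real
  assumes "c \<noteq> c'"
  shows "\<not> germ_equivalent smooth_on (D c) (D c') \<and>
         \<not> germ_equivalent real_analytic_on (D c) (D c')"
proof -
  \<comment> \<open>Smoothness is a conjunct of \<open>real_analytic_on\<close>, so the same pair of
    maps serves.\<close>
  have "germ_equivalent smooth_on (D c) (D c')" if "germ_equivalent real_analytic_on (D c) (D c')"
    using that unfolding germ_equivalent_def real_analytic_on_def by blast
  then show ?thesis
    using germ_equivalent_smooth_imp_eq assms by blast
qed

end
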